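(* For $r\geq 1$ and $n\geq 0$, the number of unit interval parking functions of length $n+r$ whose first $r$ entries are distinct equals the $r$-Fubini number $\mathrm{Fub}_n^r=\sum_{k=0}^{n}(k+r)!\left\{\begin{matrix}n+r\\k+r\end{matrix}\right\}_r$.
   Context: Unit interval parking: $N$ cars enter in order $1,\dots,N$ a one-way street with spots $1,\dots,N$; with preference list $\alpha=(a_1,\dots,a_N)\in\{1,\dots,N\}^N$, car $i$ parks in spot $a_i$ if free, otherwise in spot $a_i+1$ if it exists and is free, otherwise it fails; $\alpha$ is a unit interval parking function if all cars park. "First $r$ entries distinct" means $|\{a_1,\dots,a_r\}|=r$. The $r$-Stirling number of the second kind $\left\{\begin{matrix}n+r\\k+r\end{matrix}\right\}_r$ is the number of partitions of the set $\{1,\dots,n+r\}$ into $k+r$ nonempty blocks such that $1,\dots,r$ lie in distinct blocks. *)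

theory Defs
  imports Main "HOL-Library.Disjoint_Sets"
begin

text \<open>\<open>occ\<close> is the set of occupied spots; \<open>None\<close> means that the car fails to park.\<close>

definition unit_interval_spot :: "nat \<Rightarrow> nat set \<Rightarrow> nat \<Rightarrow> nat option" where
  "unit_interval_spot N occ a =
     (if a \<notin> occ then Some a
      else if a + 1 \<le> N \<and> a + 1 \<notin> occ then Some (a + 1)
      else None)"

primrec all_cars_park :: "nat \<Rightarrow> nat set \<Rightarrow> nat list \<Rightarrow> bool" where
  "all_cars_park N occ [] \<longleftrightarrow> True"
| "all_cars_park N occ (a # as) \<longleftrightarrow>
     (case unit_interval_spot N occ a of
        None \<Rightarrow> False
      | Some s \<Rightarrow> all_cars_park N (insert s occ) as)"

definition unit_interval_parking_function :: "nat \<Rightarrow> nat list \<Rightarrow> bool" where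
  "unit_interval_parking_function N \<alpha> \<longleftrightarrow>
     length \<alpha> = N \<and> set \<alpha> \<subseteq> {1..N} \<and> all_cars_park N {} \<alpha>"

text \<open>\<open>r_Stirling2 r m j\<close> is the $r$-Stirling number with upper entry \<open>m\<close> and lower entry
  \<open>j\<close>; neither entry is shifted by \<open>r\<close>.\<close>

definition r_Stirling2 :: "nat \<Rightarrow> nat \<Rightarrow> nat \<Rightarrow> nat" where
  "r_Stirling2 r m j =
     card {P. partition_on {1..m} P \<and> card P = j \<and>
              (\<forall>B\<in>P. \<forall>x\<in>{1..r}. \<forall>y\<in>{1..r}. x \<in> B \<and> y \<in> B \<longrightarrow> x = y)}"

definition r_Fubini :: "nat \<Rightarrow> nat \<Rightarrow> nat" where
  "r_Fubini r n = (\<Sum>k=0..n. fact (k + r) * r_Stirling2 r (n + r) (k + r))"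

end

theory Submission
  imports Defs "HOL-Combinatorics.Multiset_Permutations"
begin

text \<open>Unit interval parking functions of length \<open>N\<close> correspond to ordered set partitions of the cars:
  the blocks occupy consecutive intervals of spots, the cars of a block park from left to right in
  increasing order, the first car of a block prefers the spot where it parks, and every later car
  prefers the spot taken by its predecessor in the block. The first two cars of a block thus have
  equal preferences, so the first \<open>r\<close> entries are distinct iff the cars \<open>1, \<dots>, r\<close> lie in distinct
  blocks. A set partition into \<open>k\<close> blocks has \<open>k!\<close> orderings.\<close>

section \<open>Parking outcomes as assignments of spots to cars\<close>

text \<open>A static form of the parking process, with \<open>s i\<close> the final spot of car
  \<open>i\<close>. Injectivity of \<open>s\<close> says that each car's spot was free on arrival,
  and its range gives the bound \<open>a i + 1 \<le> N\<close>. What remains to be said is that a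
  displaced car found its preferred spot taken by an earlier car.\<close>

definition parks_at :: "nat \<Rightarrow> (nat \<Rightarrow> nat) \<Rightarrow> (nat \<Rightarrow> nat) \<Rightarrow> bool" where
  "parks_at N a s \<longleftrightarrow> bij_betw s {1..N} {1..N} \<and>
     (\<forall>i\<in>{1..N}. a i = s i \<or> a i + 1 = s i \<and> (\<exists>j\<in>{1..<i}. s j = a i))"

lemma parks_at_bij_betw: "parks_at N a s \<Longrightarrow> bij_betw s {1..N} {1..N}"
  by (simp add: parks_at_def)

lemma parks_at_inj:
  "parks_at N a s \<Longrightarrow> s i = s j \<Longrightarrow> i \<in> {1..N} \<Longrightarrow> j \<in> {1..N} \<Longrightarrow> i = j"
  by (rule inj_onD[OF bij_betw_imp_inj_on[OF parks_at_bij_betw]])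

lemma parks_atD:
  "parks_at N a s \<Longrightarrow> i \<in> {1..N} \<Longrightarrow>
     a i = s i \<or> a i + 1 = s i \<and> (\<exists>j\<in>{1..<i}. s j = a i)"
  unfolding parks_at_def by (elim conjE) (erule bspec)

lemma bij_betw_finite_endoI:
  assumes "finite A" "inj_on f A" "\<And>x. x \<in> A \<Longrightarrow> f x \<in> A"
  shows "bij_betw f A A"
  using assms by (simp add: bij_betw_def endo_inj_surj image_subsetI)

text \<open>The witness \<open>ss\<close> is the trace of the recursion. The bound by
  \<open>N\<close> stands only in the displaced case, as in \<open>unit_interval_spot\<close>; for a
  car that gets its preference the bound comes from the range of the preference list.\<close>

lemma all_cars_park_iff:
  "all_cars_park N occ as \<longleftrightarrow>
     (\<exists>ss. length ss = length as \<and> distinct ss \<and> set ss \<inter> occ = {} \<and>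
       (\<forall>i<length as. ss ! i = as ! i \<or>
          ss ! i = as ! i + 1 \<and> ss ! i \<le> N \<and> as ! i \<in> occ \<union> (!) ss ` {..<i}))"
  (is "_ \<longleftrightarrow> (\<exists>ss. ?R occ as ss)")
proof (induction as arbitrary: occ)
  case Nil
  show ?case by simp
next
  case (Cons a as)
  have img: "(!) (t # ts) ` {..<Suc i} = insert t ((!) ts ` {..<i})" for t :: nat and ts i
    by (simp add: lessThan_Suc_eq_insert_0 image_image)
  \<comment> \<open>Peels off the first car: its spot \<open>t\<close> is forced, and distinctness
    of \<open>t # ts\<close> becomes disjointness of \<open>ts\<close> from the enlarged occupied
    set.\<close>
  have step: "?R occ (a # as) (t # ts) \<longleftrightarrow>
      unit_interval_spot N occ a = Some t \<and> ?R (insert t occ) as ts" for t ts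
    by (auto simp: All_less_Suc2 img unit_interval_spot_def)
  have ex_Cons: "(\<exists>ss. length ss = length (a # as) \<and> Q ss) \<longleftrightarrow>
      (\<exists>t ts. length (t # ts) = length (a # as) \<and> Q (t # ts))" for Q :: "nat list \<Rightarrow> bool"
    by (metis length_Suc_conv length_Cons)
  have "(\<exists>ss. ?R occ (a # as) ss) \<longleftrightarrow> (\<exists>t ts. ?R occ (a # as) (t # ts))"
    by (rule ex_Cons)
  then show ?case
    unfolding step by (auto simp: Cons.IH split: option.split)
qed

text \<open>Car \<open>i\<close> is the entry at index \<open>i - 1\<close>. From right to left, the
  range condition on \<alpha> is recovered because each preference is the spot of the car itself or
  of an earlier car.\<close>

lemma unit_interval_parking_function_iff:
  "unit_interval_parking_function N \<alpha> \<longleftrightarrow>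
     length \<alpha> = N \<and> (\<exists>s. parks_at N (\<lambda>i. \<alpha> ! (i - 1)) s)"
proof
  assume "unit_interval_parking_function N \<alpha>"
  then have len: "length \<alpha> = N" and sub: "set \<alpha> \<subseteq> {1..N}" and park: "all_cars_park N {} \<alpha>"
    by (auto simp: unit_interval_parking_function_def)
  from park len obtain ss where ss: "length ss = N" "distinct ss"
    and R: "\<And>i. i < N \<Longrightarrow> ss ! i = \<alpha> ! i \<or>
          ss ! i = \<alpha> ! i + 1 \<and> ss ! i \<le> N \<and> \<alpha> ! i \<in> (!) ss ` {..<i}"
    unfolding all_cars_park_iff by auto
  let ?s = "\<lambda>i. ss ! (i - 1)"
  have \<alpha>: "\<alpha> ! i \<in> {1..N}" if "i < N" for i
    using sub len that by (meson nth_mem subsetD)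
  have "?s i \<in> {1..N}" if "i \<in> {1..N}" for i
  proof -
    have "i - 1 < N" using that by auto
    from R[OF this] \<alpha>[OF this] show ?thesis by auto
  qed
  moreover have "inj_on ?s {1..N}"
    using ss by (auto simp: inj_on_def nth_eq_iff_index_eq)
  ultimately have "bij_betw ?s {1..N} {1..N}"
    by (intro bij_betw_finite_endoI) auto
  moreover have "\<alpha> ! (i - 1) = ?s i \<or>
      \<alpha> ! (i - 1) + 1 = ?s i \<and> (\<exists>j\<in>{1..<i}. ?s j = \<alpha> ! (i - 1))" if i: "i \<in> {1..N}" for i
  proof -
    have "\<exists>j\<in>{1..<i}. ?s j = \<alpha> ! (i - 1)" if m: "m < i - 1" "\<alpha> ! (i - 1) = ss ! m" for m
      using m by (intro bexI[of _ "Suc m"]) auto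
    then show ?thesis
      using R[of "i - 1"] i by fastforce
  qed
  ultimately show "length \<alpha> = N \<and> (\<exists>s. parks_at N (\<lambda>i. \<alpha> ! (i - 1)) s)"
    using len unfolding parks_at_def by blast
next
  assume "length \<alpha> = N \<and> (\<exists>s. parks_at N (\<lambda>i. \<alpha> ! (i - 1)) s)"
  then obtain s where len: "length \<alpha> = N" and park: "parks_at N (\<lambda>i. \<alpha> ! (i - 1)) s"
    by blast
  note bij = parks_at_bij_betw[OF park] and R = parks_atD[OF park]
  have s: "s i \<in> {1..N}" if "i \<in> {1..N}" for i
    using bij that by (rule bij_betwE[rule_format])
  have "\<alpha> ! i \<in> {1..N}" if "i < N" for i
    using R[of "Suc i"] s[of "Suc i"] s that by fastforce
  then have sub: "set \<alpha> \<subseteq> {1..N}"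
    using len by (auto simp: in_set_conv_nth)
  define ss where "ss = map s [1..<Suc N]"
  have nth: "ss ! i = s (Suc i)" if "i < N" for i
    using that by (simp add: ss_def del: upt_Suc)
  have "all_cars_park N {} \<alpha>"
    unfolding all_cars_park_iff
  proof (intro exI[of _ ss] conjI allI impI)
    show "length ss = length \<alpha>" by (simp add: ss_def len)
    have "set [1..<Suc N] = {1..N}" by auto
    then show "distinct ss"
      using bij by (simp add: ss_def distinct_map bij_betw_def del: upt_Suc)
    fix i assume "i < length \<alpha>"
    then have i: "i < N" by (simp add: len)
    have "\<alpha> ! i \<in> (!) ss ` {..<i}" if "j \<in> {1..<Suc i}" "s j = \<alpha> ! i" for j
      using that i nth[of "j - 1"] by (intro image_eqI[of _ _ "j - 1"]) auto
    then show "ss ! i = \<alpha> ! i \<or>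
        ss ! i = \<alpha> ! i + 1 \<and> ss ! i \<le> N \<and> \<alpha> ! i \<in> {} \<union> (!) ss ` {..<i}"
      using R[of "Suc i"] s[of "Suc i"] nth[OF i] i by auto
  qed auto
  then show "unit_interval_parking_function N \<alpha>"
    using len sub by (simp add: unit_interval_parking_function_def)
qed

text \<open>Parking is deterministic. If the earlier cars agree, both outcomes see the same status
  of \<open>a i\<close>: taken forces \<open>a i + 1\<close> by injectivity, free forces
  \<open>a i\<close>.\<close>

lemma parks_at_unique:
  assumes "parks_at N a s" "parks_at N a s'" "i \<in> {1..N}"
  shows "s i = s' i"
  using assms(3)
proof (induction i rule: less_induct)
  case (less i)
  have eq: "s j = s' j" if "j \<in> {1..<i}" for j
    using less that by auto
  have ne: "s j \<noteq> s i" "s' j \<noteq> s' i" if "j \<in> {1..<i}" for j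
    using parks_at_inj[OF assms(1), of j i] parks_at_inj[OF assms(2), of j i] less.prems that
    by auto
  have "a i = s i \<or> a i + 1 = s i \<and> (\<exists>j\<in>{1..<i}. s j = a i)"
    "a i = s' i \<or> a i + 1 = s' i \<and> (\<exists>j\<in>{1..<i}. s' j = a i)"
    using parks_atD[OF assms(1) less.prems] parks_atD[OF assms(2) less.prems] .
  with eq ne show ?case by metis
qed

text \<open>The first displaced car among the first \<open>r\<close> prefers the spot of an earlier
  car, which itself got its preference, so a preference is repeated. The converse is injectivity of
  \<open>s\<close>.\<close>

lemma parks_at_inj_on_iff:
  assumes "parks_at N a s" "r \<le> N"
  shows "inj_on a {1..r} \<longleftrightarrow> (\<forall>i\<in>{1..r}. a i = s i)"
proof
  assume "\<forall>i\<in>{1..r}. a i = s i"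
  moreover have "inj_on s {1..r}"
    using assms by (auto simp: parks_at_def bij_betw_def intro: inj_on_subset)
  ultimately show "inj_on a {1..r}"
    by (metis inj_on_cong)
next
  assume inj: "inj_on a {1..r}"
  have "i \<in> {1..r} \<longrightarrow> a i = s i" for i
  proof (induction i rule: less_induct)
    case (less i)
    show ?case
    proof (rule impI, rule ccontr)
      assume i: "i \<in> {1..r}" and "a i \<noteq> s i"
      then obtain j where j: "j \<in> {1..<i}" "s j = a i"
        using parks_atD[OF assms(1), of i] assms(2) by auto
      with less i have "a j = a i" by auto
      with inj i j show False
        by (auto dest!: inj_onD)
    qed
  qed
  then show "\<forall>i\<in>{1..r}. a i = s i" by blast
qed

section \<open>From ordered set partitions to preference lists\<close>

text \<open>A surjection \<open>g\<close> onto an initial segment encodes the ordered set partition whose \<open>v\<close>-th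
  block is the fibre over \<open>v\<close>. Listing the blocks one after the other, each in increasing order,
  puts \<open>i\<close> at position \<open>lex_rank N g i\<close>.\<close>

definition lex_rank :: "nat \<Rightarrow> (nat \<Rightarrow> nat) \<Rightarrow> nat \<Rightarrow> nat" where
  "lex_rank N g i = card {j\<in>{1..N}. g j < g i \<or> g j = g i \<and> j \<le> i}"

definition block_first :: "(nat \<Rightarrow> nat) \<Rightarrow> nat \<Rightarrow> bool" where
  "block_first g i \<longleftrightarrow> (\<forall>j\<in>{1..<i}. g j \<noteq> g i)"

text \<open>Blocks are listed contiguously, so for a car that is not first in its block the rank
  minus one is the spot of its predecessor in the block.\<close>

definition block_pref :: "nat \<Rightarrow> (nat \<Rightarrow> nat) \<Rightarrow> nat \<Rightarrow> nat" where
  "block_pref N g i = (if block_first g i then lex_rank N g i else lex_rank N g i - 1)"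

text \<open>The sets counted by the ranks are initial segments of the lexicographic order on the
  pairs \<open>(g i, i)\<close>, so a smaller pair yields a proper subset.\<close>

lemma lex_rank_le_iff:
  assumes "i \<in> {1..N}" "j \<in> {1..N}"
  shows "lex_rank N g i \<le> lex_rank N g j \<longleftrightarrow> g i < g j \<or> g i = g j \<and> i \<le> j"
proof -
  have less: "lex_rank N g x < lex_rank N g y"
    if "x \<in> {1..N}" "y \<in> {1..N}" "g x < g y \<or> g x = g y \<and> x < y" for x y
    unfolding lex_rank_def
  proof (rule psubset_card_mono)
    show "{j\<in>{1..N}. g j < g x \<or> g j = g x \<and> j \<le> x}
        \<subset> {j\<in>{1..N}. g j < g y \<or> g j = g y \<and> j \<le> y}"
    proof (rule psubsetI)
      have "y \<in> {j\<in>{1..N}. g j < g y \<or> g j = g y \<and> j \<le> y}"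
        "y \<notin> {j\<in>{1..N}. g j < g x \<or> g j = g x \<and> j \<le> x}"
        using that by auto
      then show "{j\<in>{1..N}. g j < g x \<or> g j = g x \<and> j \<le> x}
        \<noteq> {j\<in>{1..N}. g j < g y \<or> g j = g y \<and> j \<le> y}" by blast
    qed (use that in auto)
  qed simp
  show ?thesis
    using less[of i j] less[of j i] assms
    by (cases "g i" "g j" rule: linorder_cases; cases i j rule: linorder_cases) auto
qed

lemma lex_rank_bij_betw: "bij_betw (lex_rank N g) {1..N} {1..N}"
proof -
  have "inj_on (lex_rank N g) {1..N}"
  proof (rule inj_onI)
    fix x y assume "x \<in> {1..N}" "y \<in> {1..N}" "lex_rank N g x = lex_rank N g y"
    then show "x = y"
      using lex_rank_le_iff[of x N y g] lex_rank_le_iff[of y N x g] by auto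
  qed
  moreover have "lex_rank N g i \<in> {1..N}" if "i \<in> {1..N}" for i
  proof -
    have "{j\<in>{1..N}. g j < g i \<or> g j = g i \<and> j \<le> i} \<noteq> {}"
      using that by auto
    then have "lex_rank N g i > 0"
      by (simp add: lex_rank_def card_gt_0_iff)
    moreover have "lex_rank N g i \<le> card {1..N}"
      unfolding lex_rank_def by (rule card_mono) auto
    ultimately show ?thesis by simp
  qed
  ultimately show ?thesis
    by (intro bij_betw_finite_endoI) auto
qed

lemma lex_rank_pos: "i \<in> {1..N} \<Longrightarrow> lex_rank N g i > 0"
  using bij_betwE[OF lex_rank_bij_betw[of N g]] by fastforce

lemma block_pref_eq_lex_rank_iff:
  "i \<in> {1..N} \<Longrightarrow> block_pref N g i = lex_rank N g i \<longleftrightarrow> block_first g i"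
  using lex_rank_pos[of i N g] by (auto simp: block_pref_def)

lemma parks_at_block_pref: "parks_at N (block_pref N g) (lex_rank N g)"
  unfolding parks_at_def
proof (intro conjI ballI lex_rank_bij_betw)
  fix i assume i: "i \<in> {1..N}"
  show "block_pref N g i = lex_rank N g i \<or>
    block_pref N g i + 1 = lex_rank N g i \<and> (\<exists>j\<in>{1..<i}. lex_rank N g j = block_pref N g i)"
  proof (cases "block_first g i")
    case True
    then show ?thesis by (simp add: block_pref_def)
  next
    case False
    define S where "S = {j\<in>{1..<i}. g j = g i}"
    have S: "finite S" "S \<noteq> {}"
      using False by (auto simp: S_def block_first_def)
    \<comment> \<open>The immediate predecessor of \<open>i\<close> in its block. No car lies
      strictly between \<open>m\<close> and \<open>i\<close> lexicographically, so the ranks differ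
      by exactly one.\<close>
    define m where "m = Max S"
    have m: "m \<in> {1..<i}" "g m = g i"
      using Max_in[OF S] by (auto simp: m_def S_def)
    have le_m: "j \<le> m" if "1 \<le> j" "j < i" "g j = g i" for j
      using that S by (auto simp: m_def S_def)
    have "{j\<in>{1..N}. g j < g i \<or> g j = g i \<and> j \<le> i}
        = insert i {j\<in>{1..N}. g j < g m \<or> g j = g m \<and> j \<le> m}"
      using i m le_m by (auto simp: le_less)
    moreover have "i \<notin> {j\<in>{1..N}. g j < g m \<or> g j = g m \<and> j \<le> m}"
      using m by auto
    ultimately have "lex_rank N g i = Suc (lex_rank N g m)"
      by (simp add: lex_rank_def)
    then show ?thesis
      using False m by (auto simp: block_pref_def)
  qed
qed

text \<open>Each of the blocks \<open>0, ..., g i\<close> has exactly one first car, and these are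
  the first cars ranked no later than \<open>i\<close>; no label is skipped because the image of
  \<open>g\<close> is an initial segment. Thus \<open>g\<close> can be read off from the ranks and
  the first cars.\<close>

lemma Suc_eq_card_block_first:
  assumes g: "g ` {1..N} = {..<k}" and i: "i \<in> {1..N}"
  shows "Suc (g i) = card {j\<in>{1..N}. block_first g j \<and> lex_rank N g j \<le> lex_rank N g i}"
    (is "_ = card ?F")
proof -
  have "inj_on g ?F"
  proof (rule inj_onI)
    fix x y assume "x \<in> ?F" "y \<in> ?F" "g x = g y"
    then show "x = y"
      by (cases x y rule: linorder_cases) (auto simp: block_first_def)
  qed
  moreover have "g ` ?F = {..g i}"
  proof (intro equalityI subsetI)
    fix v assume "v \<in> g ` ?F"
    then show "v \<in> {..g i}"
      using i by (auto simp: lex_rank_le_iff)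
  next
    fix v assume v: "v \<in> {..g i}"
    have "g i \<in> {..<k}" using g i by blast
    with v have "v \<in> g ` {1..N}" using g by auto
    then have ex: "\<exists>j. j \<in> {1..N} \<and> g j = v" by auto
    define m where "m = (LEAST j. j \<in> {1..N} \<and> g j = v)"
    have m: "m \<in> {1..N}" "g m = v"
      using LeastI_ex[OF ex] by (auto simp: m_def)
    have least: "m \<le> j" if "j \<in> {1..N}" "g j = v" for j
      unfolding m_def using that by (intro Least_le) auto
    have "block_first g m"
      unfolding block_first_def using m least by force
    moreover have "lex_rank N g m \<le> lex_rank N g i"
      using m v least[of i] i by (auto simp: lex_rank_le_iff)
    ultimately show "v \<in> g ` ?F" using m by blast
  qed
  ultimately show ?thesis
    using card_image by force
qed

text \<open>By determinism the preferences fix the ranks, and then the first cars, which are those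
  whose preference equals their rank. Counting first cars recovers the label.\<close>

lemma block_pref_inj:
  assumes g: "g ` {1..N} = {..<k}" and h: "h ` {1..N} = {..<l}"
    and eq: "\<And>i. i \<in> {1..N} \<Longrightarrow> block_pref N g i = block_pref N h i" and i: "i \<in> {1..N}"
  shows "g i = h i"
proof -
  have "parks_at N (block_pref N g) (lex_rank N h)"
    using parks_at_block_pref[of N h] eq by (simp add: parks_at_def)
  then have rank: "lex_rank N g j = lex_rank N h j" if "j \<in> {1..N}" for j
    using parks_at_unique[OF parks_at_block_pref] that by blast
  have "block_first g j \<longleftrightarrow> block_first h j" if "j \<in> {1..N}" for j
    using that eq rank block_pref_eq_lex_rank_iff by metis
  then have "{j\<in>{1..N}. block_first g j \<and> lex_rank N g j \<le> lex_rank N g i}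
    = {j\<in>{1..N}. block_first h j \<and> lex_rank N h j \<le> lex_rank N h i}"
    using rank i by auto
  then show ?thesis
    using Suc_eq_card_block_first[OF g i] Suc_eq_card_block_first[OF h i] by simp
qed

section \<open>From parking outcomes back to ordered set partitions\<close>

text \<open>The blocks are recovered from the parking outcome: a new block starts at each spot whose car
  parks at its preferred spot.\<close>

lemma parks_at_imp_block_pref:
  assumes "parks_at N a s"
  shows "\<exists>g\<in>extensional {1..N}. (\<exists>k. g ` {1..N} = {..<k}) \<and> (\<forall>i\<in>{1..N}. a i = block_pref N g i)"
proof -
  note bij = parks_at_bij_betw[OF assms] and R = parks_atD[OF assms]
  have s: "s i \<in> {1..N}" if "i \<in> {1..N}" for i
    using bij that by (rule bij_betwE[rule_format])
  note s_inj = parks_at_inj[OF assms]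
  \<comment> \<open>\<open>L\<close> holds the cars that get their preference, so \<open>H t\<close>
    is the number of blocks starting at or before spot \<open>t\<close>. The \<open>- 1\<close> in
    \<open>g\<close> makes labels start at 0.\<close>
  define L where "L = {j\<in>{1..N}. a j = s j}"
  define H where "H t = card {j\<in>L. s j \<le> t}" for t
  define g where "g = restrict (\<lambda>i. H (s i) - 1) {1..N}"
  have fin: "finite {j\<in>L. P j}" for P by (simp add: L_def)
  have H_mono: "H t \<le> H u" if "t \<le> u" for t u
    unfolding H_def using that by (intro card_mono fin) auto
  have H_lucky: "H (Suc t) = Suc (H t)" if "j \<in> L" "s j = Suc t" for j t
  proof -
    have "{j\<in>L. s j \<le> Suc t} = insert j {j\<in>L. s j \<le> t}"
      using that s_inj by (auto simp: L_def le_Suc_eq)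
    then show ?thesis using that fin by (simp add: H_def)
  qed
  have H_unlucky: "H (Suc t) = H t" if "j \<in> {1..N} - L" "s j = Suc t" for j t
  proof -
    have "s m \<noteq> Suc t" if "m \<in> L" for m
      using that \<open>j \<in> {1..N} - L\<close> \<open>s j = Suc t\<close> s_inj[of m j] by (auto simp: L_def)
    then have "{j\<in>L. s j \<le> Suc t} = {j\<in>L. s j \<le> t}"
      by (auto simp: le_Suc_eq)
    then show ?thesis by (simp add: H_def)
  qed
  have ex_car: "\<exists>j\<in>{1..N}. s j = t" if "t \<in> {1..N}" for t
    using bij that by (metis bij_betw_imp_surj_on imageE)
  have H0: "H 0 = 0"
    using s by (fastforce simp: H_def L_def)
  \<comment> \<open>A displaced car at spot 1 would prefer spot 0, where no car parks. Hence a block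
    starts at spot 1, and the \<open>- 1\<close> in \<open>g\<close> never truncates.\<close>
  have H1: "H 1 = 1" if N: "1 \<le> N"
  proof -
    obtain j where j: "j \<in> {1..N}" "s j = 1" using ex_car[of 1] N by auto
    have "a j = s j"
    proof (rule ccontr)
      assume "a j \<noteq> s j"
      then obtain m where "m \<in> {1..<j}" "s m = 0" using R[OF j(1)] j(2) by auto
      then show False using s[of m] j by auto
    qed
    then show ?thesis using H_lucky[of j 0] j H0 by (simp add: L_def)
  qed
  have H_pos: "H t \<ge> 1" if "t \<in> {1..N}" for t
    using H_mono[of 1 t] H1 that by auto
  have g_eq: "g i = H (s i) - 1" if "i \<in> {1..N}" for i
    using that by (simp add: g_def)
  have g_le: "g i \<le> g j \<longleftrightarrow> H (s i) \<le> H (s j)" if "i \<in> {1..N}" "j \<in> {1..N}" for i j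
    using that H_pos[OF s[OF that(1)]] H_pos[OF s[OF that(2)]] by (auto simp: g_eq)

  have pred: "\<exists>j\<in>{1..<i}. s j = t \<and> H (Suc t) = H t"
    if i: "i \<in> {1..N}" "s i = Suc t" "i \<notin> L" for i t
    using R[of i] H_unlucky[of i t] i by (auto simp: L_def)
  \<comment> \<open>Descends from spot \<open>s i\<close> one spot at a time: no block starts
    between \<open>s j\<close> and \<open>s i\<close>, so the car just behind is an earlier car of
    the same block, until \<open>j\<close> is reached.\<close>
  have block_mono: "j < i"
    if "i \<in> {1..N}" "j \<in> {1..N}" "s j < s i" "H (s j) = H (s i)" for i j
    using that
  proof (induction "s i" arbitrary: i rule: less_induct)
    case less
    obtain t where t: "s i = Suc t" using less.prems by (cases "s i") auto
    have "i \<notin> L"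
    proof
      assume "i \<in> L"
      then have "H (s i) = Suc (H t)" using H_lucky t by simp
      moreover have "H (s j) \<le> H t" using less.prems t by (intro H_mono) simp
      ultimately show False using less.prems by simp
    qed
    then obtain m where m: "m \<in> {1..<i}" "s m = t" "H (Suc t) = H t"
      using pred less.prems t by blast
    then have mN: "m \<in> {1..N}" using less.prems by auto
    show ?case
    proof (cases "s j = t")
      case True
      then have "j = m" using s_inj m mN less.prems by auto
      then show ?thesis using m by simp
    next
      case False
      then have "j < m" using less.hyps[of m] less.prems m mN t by auto
      then show ?thesis using m by simp
    qed
  qed
  \<comment> \<open>Monotonicity of \<open>H\<close> orders different blocks, and
    \<open>block_mono\<close> orders the cars inside one block.\<close>
  have order: "g j < g i \<or> g j = g i \<and> j \<le> i \<longleftrightarrow> s j \<le> s i"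
    if "i \<in> {1..N}" "j \<in> {1..N}" for i j
  proof (cases "s j" "s i" rule: linorder_cases)
    case less
    then show ?thesis
      using g_le[of j i] g_le[of i j] H_mono[of "s j" "s i"] block_mono[of i j] that by auto
  next
    case equal
    then show ?thesis using s_inj that by auto
  next
    case greater
    then show ?thesis
      using g_le[of j i] g_le[of i j] H_mono[of "s i" "s j"] block_mono[of j i] that by auto
  qed
  have rank: "lex_rank N g i = s i" if i: "i \<in> {1..N}" for i
  proof -
    have "lex_rank N g i = card {j\<in>{1..N}. s j \<le> s i}"
      unfolding lex_rank_def by (rule arg_cong[of _ _ card]) (use order i in auto)
    also have "\<dots> = card (s ` {j\<in>{1..N}. s j \<le> s i})"
      by (rule card_image[symmetric]) (auto intro!: inj_onI s_inj)
    also have "s ` {j\<in>{1..N}. s j \<le> s i} = {1..s i}"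
      using s ex_car s[OF i] by (fastforce simp: image_iff)
    finally show ?thesis by simp
  qed
  \<comment> \<open>A car in \<open>L\<close> raises \<open>H\<close> at its own spot, so no car at
    a smaller spot shares its label, and by \<open>order\<close> an earlier car with the same label
    would be at one. A displaced car has an earlier car of its block directly behind it.\<close>
  have first: "block_first g i \<longleftrightarrow> a i = s i" if i: "i \<in> {1..N}" for i
  proof
    assume lucky: "a i = s i"
    then have iL: "i \<in> L" using i by (simp add: L_def)
    show "block_first g i"
      unfolding block_first_def
    proof (rule ballI, rule notI)
      fix j assume j: "j \<in> {1..<i}" and eq: "g j = g i"
      then have jN: "j \<in> {1..N}" using i by auto
      have "s j \<noteq> s i" using s_inj[of j i] j jN i by auto
      then have "s j < s i" using order[OF i jN] j eq by auto
      then obtain t where t: "s i = Suc t" "s j \<le> t" by (cases "s i") auto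
      then have "H (s j) < H (s i)" using H_lucky[OF iL t(1)] H_mono[of "s j" t] by simp
      then show False using g_le[of i j] eq i jN by simp
    qed
  next
    assume bf: "block_first g i"
    show "a i = s i"
    proof (rule ccontr)
      assume ne: "a i \<noteq> s i"
      obtain t where t: "s i = Suc t" using s[OF i] by (cases "s i") auto
      obtain m where m: "m \<in> {1..<i}" "s m = t" "H (Suc t) = H t"
        using pred[OF i t] ne by (auto simp: L_def)
      then have "g m = g i" using i t by (auto simp: g_eq)
      then show False using bf m by (auto simp: block_first_def)
    qed
  qed
  have pref: "a i = block_pref N g i" if i: "i \<in> {1..N}" for i
    using R[OF i] first[OF i] rank[OF i] by (auto simp: block_pref_def)
  \<comment> \<open>\<open>H\<close> starts at 0 and grows by at most one per spot, so no label is
    skipped.\<close>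
  have "{..<H t} \<subseteq> (\<lambda>u. H u - 1) ` {1..t}" if "t \<le> N" for t
    using that
  proof (induction t)
    case 0
    show ?case by (simp add: H0)
  next
    case (Suc t)
    obtain j where j: "j \<in> {1..N}" "s j = Suc t" using ex_car[of "Suc t"] Suc.prems by auto
    have "H (Suc t) \<le> Suc (H t)"
      using H_lucky[of j t] H_unlucky[of j t] j by (cases "j \<in> L") auto
    then have "{..<H (Suc t)} \<subseteq> insert (H (Suc t) - 1) {..<H t}" by auto
    then show ?case using Suc by (fastforce simp: atLeastAtMostSuc_conv)
  qed
  then have "{..<H N} \<subseteq> (\<lambda>u. H u - 1) ` (s ` {1..N})"
    using bij by (simp add: bij_betw_imp_surj_on)
  also have "\<dots> = g ` {1..N}"
    by (simp add: image_image g_eq cong: image_cong_simp)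
  finally have "{..<H N} \<subseteq> g ` {1..N}" .
  moreover have "g i < H N" if "i \<in> {1..N}" for i
    using H_pos[OF s[OF that]] H_mono[of "s i" N] s[OF that] g_eq[OF that] by auto
  ultimately have "g ` {1..N} = {..<H N}" by auto
  moreover have "g \<in> extensional {1..N}" by (simp add: g_def)
  ultimately show ?thesis using pref by blast
qed

section \<open>Counting ordered set partitions\<close>

text \<open>Listing the fibres in label order identifies \<open>g\<close> with an ordering of the
  blocks of a set partition, and \<open>k\<close> blocks have \<open>fact k\<close> orderings. The
  condition \<open>Q\<close> sees only the unordered partition, so it passes through the
  count.\<close>

lemma card_surjections_with_fibres:
  assumes "finite A"
  shows "card {g \<in> extensional A. g ` A = {..<k} \<and> Q ((\<lambda>v. {i\<in>A. g i = v}) ` {..<k})}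
    = fact k * card {P. partition_on A P \<and> card P = k \<and> Q P}"
    (is "card ?G = _ * card ?S")
proof -
  define blk where "blk g v = {i\<in>A. g i = v}" for g :: "'a \<Rightarrow> nat" and v
  define F where "F g = map (blk g) [0..<k]" for g :: "'a \<Rightarrow> nat"
  have finS: "finite ?S"
    by (rule finite_subset[of _ "Pow (Pow A)"]) (use assms in \<open>auto simp: partition_on_def\<close>)
  have fin: "finite P" if "P \<in> ?S" for P
    using that assms finite_elements by blast
  have "bij_betw F ?G (\<Union>P\<in>?S. permutations_of_set P)"
  proof (rule bij_betw_imageI)
    show "inj_on F ?G"
    proof (rule inj_onI)
      fix g h assume g: "g \<in> ?G" and h: "h \<in> ?G" and eq: "F g = F h"
      have "g x = h x" if x: "x \<in> A" for x
      proof -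
        have "g x < k" using g x by auto
        then have "blk g (g x) = blk h (g x)"
          using arg_cong[OF eq, of "\<lambda>xs. xs ! g x"] by (simp add: F_def)
        then have "x \<in> blk h (g x)" using x by (auto simp: blk_def)
        then show ?thesis by (simp add: blk_def)
      qed
      then show "g = h" using g h by (auto intro: extensionalityI)
    qed
    show "F ` ?G = (\<Union>P\<in>?S. permutations_of_set P)"
    proof (intro equalityI subsetI)
      fix Bs assume "Bs \<in> F ` ?G"
      then obtain g where g: "g ` A = {..<k}" "Q (blk g ` {..<k})" and Bs: "Bs = F g"
        by (auto simp: blk_def)
      have ne: "blk g v \<noteq> {}" if "v < k" for v
      proof -
        have "v \<in> g ` A" using g that by simp
        then show ?thesis by (auto simp: blk_def)
      qed
      have inj: "inj_on (blk g) {..<k}"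
        using ne by (fastforce simp: inj_on_def blk_def)
      have "partition_on A (blk g ` {..<k})"
      proof (rule partition_onI)
        show "\<Union> (blk g ` {..<k}) = A" using g by (auto simp: blk_def)
        show "disjnt p q" if "p \<in> blk g ` {..<k}" "q \<in> blk g ` {..<k}" "p \<noteq> q" for p q
          using that by (auto simp: blk_def disjnt_def)
      qed (use ne in auto)
      moreover have "card (blk g ` {..<k}) = k" using card_image[OF inj] by simp
      moreover have "Bs \<in> permutations_of_set (blk g ` {..<k})"
        using inj by (simp add: Bs F_def permutations_of_set_def distinct_map atLeast0LessThan)
      ultimately show "Bs \<in> (\<Union>P\<in>?S. permutations_of_set P)" using g by blast
    next
      fix Bs assume "Bs \<in> (\<Union>P\<in>?S. permutations_of_set P)"
      then have P: "partition_on A (set Bs)" "card (set Bs) = k" "Q (set Bs)" and d: "distinct Bs"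
        by (auto simp: permutations_of_set_def)
      have len: "length Bs = k" using d P by (simp add: distinct_card)
      have ex: "\<exists>v<k. x \<in> Bs ! v" if "x \<in> A" for x
        using that partition_onD1[OF P(1)] len by (auto simp: in_set_conv_nth)
      have uniq: "u = v" if "u < k" "v < k" "x \<in> Bs ! u" "x \<in> Bs ! v" for u v x
        using that partition_onD2[OF P(1)] len d
        by (metis disjointD disjoint_iff nth_eq_iff_index_eq nth_mem)
      \<comment> \<open>The inverse map: an element is labelled by the index of its block, unique
        since the blocks are disjoint and \<open>Bs\<close> is distinct.\<close>
      define g where "g = restrict (\<lambda>x. SOME v. v < k \<and> x \<in> Bs ! v) A"
      have g: "g x < k \<and> x \<in> Bs ! g x" if "x \<in> A" for x
        using someI_ex[OF ex[OF that]] that by (simp add: g_def)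
      have sub: "Bs ! v \<subseteq> A" if "v < k" for v
        using that len partition_onD1[OF P(1)] by (metis Union_upper nth_mem)
      have blk: "blk g v = Bs ! v" if "v < k" for v
        using that g sub uniq by (auto simp: blk_def) blast+
      have FB: "F g = Bs"
        using blk len by (auto simp: F_def intro!: nth_equalityI)
      have ne: "Bs ! v \<noteq> {}" if "v < k" for v
        using that len partition_onD3[OF P(1)] by (metis nth_mem)
      have "v \<in> g ` A" if "v < k" for v
        using ne[OF that] blk[OF that] by (auto simp: blk_def)
      then have "g ` A = {..<k}" using g by auto
      moreover have "blk g ` {..<k} = set Bs"
        using arg_cong[OF FB, of set] by (simp add: F_def atLeast0LessThan)
      then have "Q ((\<lambda>v. {i\<in>A. g i = v}) ` {..<k})"
        using P(3) by (simp add: blk_def cong: image_cong_simp)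
      ultimately have "g \<in> ?G" by (simp add: g_def)
      then show "Bs \<in> F ` ?G" using FB by blast
    qed
  qed
  then have "card ?G = card (\<Union>P\<in>?S. permutations_of_set P)"
    by (rule bij_betw_same_card)
  \<comment> \<open>The union is disjoint because a list determines its set of entries.\<close>
  also have "\<dots> = (\<Sum>P\<in>?S. card (permutations_of_set P))"
  proof (rule card_UN_disjoint)
    show "\<forall>P\<in>?S. \<forall>P'\<in>?S. P \<noteq> P' \<longrightarrow> permutations_of_set P \<inter> permutations_of_set P' = {}"
      by (auto simp: permutations_of_set_def)
  qed (use finS in auto)
  also have "\<dots> = (\<Sum>P\<in>?S. fact k)"
  proof (rule sum.cong[OF refl])
    fix P assume "P \<in> ?S"
    with card_permutations_of_set[OF fin[OF this]] show "card (permutations_of_set P) = fact k"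
      by simp
  qed
  finally show ?thesis by simp
qed

text \<open>Sending each of \<open>1, ..., r\<close> to its block is injective by the separation
  condition, so there are at least \<open>r\<close> blocks.\<close>

lemma r_Stirling2_eq_0:
  assumes "k < r" "r \<le> m"
  shows "r_Stirling2 r m k = 0"
proof -
  have "r \<le> card P" if P: "partition_on {1..m} P"
    and sep: "\<forall>B\<in>P. \<forall>x\<in>{1..r}. \<forall>y\<in>{1..r}. x \<in> B \<and> y \<in> B \<longrightarrow> x = y" for P
  proof -
    have "\<forall>x\<in>{1..r}. \<exists>B\<in>P. x \<in> B"
      using partition_onD1[OF P] assms by (metis Union_iff atLeastAtMost_iff order_trans)
    then obtain f where f: "\<forall>x\<in>{1..r}. f x \<in> P \<and> x \<in> f x" by metis
    then have "inj_on f {1..r}" using sep by (metis inj_onI)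
    moreover have "finite P" using P finite_elements by blast
    ultimately have "card {1..r} \<le> card P" using f by (intro card_inj_on_le) auto
    then show ?thesis by simp
  qed
  then have "{P. partition_on {1..m} P \<and> card P = k \<and>
      (\<forall>B\<in>P. \<forall>x\<in>{1..r}. \<forall>y\<in>{1..r}. x \<in> B \<and> y \<in> B \<longrightarrow> x = y)} = {}"
    using assms by fastforce
  then show ?thesis unfolding r_Stirling2_def by (simp only: card.empty)
qed

text \<open>Injectivity on \<open>{1..r}\<close> says that no fibre contains two of
  \<open>1, ..., r\<close>, which is the separation condition of \<open>r_Stirling2\<close>;
  \<open>r \<le> m\<close> puts these elements in the domain.\<close>

lemma card_surjections_inj_on:
  assumes "r \<le> m"
  shows "card {g \<in> extensional {1..m}. g ` {1..m} = {..<k} \<and> inj_on g {1..r}}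
    = fact k * r_Stirling2 r m k"
proof -
  let ?Q = "\<lambda>P. \<forall>B\<in>P. \<forall>x\<in>{1..r}. \<forall>y\<in>{1..r}. x \<in> B \<and> y \<in> B \<longrightarrow> x = y"
  have inj_iff: "inj_on g {1..r} \<longleftrightarrow> ?Q ((\<lambda>v. {i\<in>{1..m}. g i = v}) ` {..<k})"
    if g: "g ` {1..m} = {..<k}" for g :: "nat \<Rightarrow> nat"
  proof -
    have lt: "g x < k" if "x \<in> {1..r}" for x
      using g that assms by (metis atLeastAtMost_iff imageI lessThan_iff order_trans)
    show ?thesis
    proof
      assume "inj_on g {1..r}"
      then show "?Q ((\<lambda>v. {i\<in>{1..m}. g i = v}) ` {..<k})"
        by (auto dest: inj_onD)
    next
      assume Q: "?Q ((\<lambda>v. {i\<in>{1..m}. g i = v}) ` {..<k})"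
      show "inj_on g {1..r}"
      proof (rule inj_onI)
        fix x y assume xy: "x \<in> {1..r}" "y \<in> {1..r}" "g x = g y"
        then have "{i\<in>{1..m}. g i = g x} \<in> (\<lambda>v. {i\<in>{1..m}. g i = v}) ` {..<k}"
          using lt by (intro image_eqI[of _ _ "g x"]) auto
        from bspec[OF bspec[OF bspec[OF Q this] xy(1)] xy(2)] xy assms show "x = y" by simp
      qed
    qed
  qed
  have "{g \<in> extensional {1..m}. g ` {1..m} = {..<k} \<and> inj_on g {1..r}}
    = {g \<in> extensional {1..m}. g ` {1..m} = {..<k} \<and> ?Q ((\<lambda>v. {i\<in>{1..m}. g i = v}) ` {..<k})}"
    by (intro Collect_cong conj_cong refl inj_iff)
  then show ?thesis
    unfolding r_Stirling2_def
    using card_surjections_with_fibres[of "{1..m}" k ?Q] by simp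
qed

section \<open>The bijection and the final summation\<close>

lemma bij_betw_block_pref:
  assumes "r \<le> N"
  shows "bij_betw (\<lambda>g. map (block_pref N g) [1..<Suc N])
    (\<Union>k\<le>N. {g \<in> extensional {1..N}. g ` {1..N} = {..<k} \<and> inj_on g {1..r}})
    {\<alpha>. unit_interval_parking_function N \<alpha> \<and> card (set (take r \<alpha>)) = r}"
    (is "bij_betw ?F ?G ?U")
proof (rule bij_betw_imageI)
  have nth: "map f [1..<Suc N] ! (i - 1) = f i" if "i \<in> {1..N}" for f :: "nat \<Rightarrow> nat" and i
    using that by (subst nth_map) (auto simp del: upt_Suc)
  have set_take: "set (take r (map f [1..<Suc N])) = f ` {1..r}" for f :: "nat \<Rightarrow> nat"
    using assms by (auto simp: take_map take_upt simp del: upt_Suc)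
  \<comment> \<open>The chain runs from distinct preferences, via every one of the first
    \<open>r\<close> cars getting its preference and being first in its block, to these cars lying
    in distinct blocks.\<close>
  have distinct_iff: "card (set (take r (?F g))) = r \<longleftrightarrow> inj_on g {1..r}" for g
  proof -
    have "card (set (take r (?F g))) = r \<longleftrightarrow> inj_on (block_pref N g) {1..r}"
      unfolding set_take by (simp add: inj_on_iff_eq_card)
    also have "\<dots> \<longleftrightarrow> (\<forall>i\<in>{1..r}. block_pref N g i = lex_rank N g i)"
      by (rule parks_at_inj_on_iff[OF parks_at_block_pref assms])
    also have "\<dots> \<longleftrightarrow> (\<forall>i\<in>{1..r}. block_first g i)"
      using assms by (simp add: block_pref_eq_lex_rank_iff)
    also have "\<dots> \<longleftrightarrow> inj_on g {1..r}"
    proof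
      assume bf: "\<forall>i\<in>{1..r}. block_first g i"
      show "inj_on g {1..r}"
        by (rule linorder_inj_onI) (use bf in \<open>auto simp: block_first_def\<close>)
    next
      assume inj: "inj_on g {1..r}"
      show "\<forall>i\<in>{1..r}. block_first g i"
        using inj_onD[OF inj] by (fastforce simp: block_first_def)
    qed
    finally show ?thesis .
  qed
  show "inj_on ?F ?G"
  proof (rule inj_onI)
    fix g h assume g: "g \<in> ?G" and h: "h \<in> ?G" and eq: "?F g = ?F h"
    have "block_pref N g i = block_pref N h i" if "i \<in> {1..N}" for i
      using nth[OF that, of "block_pref N g"] nth[OF that, of "block_pref N h"] eq by metis
    moreover obtain k l where "g ` {1..N} = {..<k}" "h ` {1..N} = {..<l}"
      using g h by blast
    ultimately have "g i = h i" if "i \<in> {1..N}" for i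
      using block_pref_inj that by metis
    then show "g = h" using g h by (auto intro: extensionalityI[of _ "{1..N}"])
  qed
  show "?F ` ?G = ?U"
  proof (intro equalityI subsetI)
    fix \<alpha> assume "\<alpha> \<in> ?F ` ?G"
    then obtain g where \<alpha>: "\<alpha> = ?F g" and inj: "inj_on g {1..r}" by blast
    have "parks_at N (\<lambda>i. ?F g ! (i - 1)) (lex_rank N g)"
      using parks_at_block_pref[of N g] nth[of _ "block_pref N g"]
      by (simp add: parks_at_def del: upt_Suc)
    then show "\<alpha> \<in> ?U"
      using distinct_iff[of g] inj unfolding \<alpha> unit_interval_parking_function_iff
      by (auto simp del: upt_Suc)
  next
    fix \<alpha> assume U: "\<alpha> \<in> ?U"
    then obtain s where len: "length \<alpha> = N" and s: "parks_at N (\<lambda>i. \<alpha> ! (i - 1)) s"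
      by (auto simp: unit_interval_parking_function_iff)
    obtain g k where g: "g \<in> extensional {1..N}" "g ` {1..N} = {..<k}"
      and pref: "\<forall>i\<in>{1..N}. \<alpha> ! (i - 1) = block_pref N g i"
      using parks_at_imp_block_pref[OF s] by blast
    have \<alpha>: "\<alpha> = ?F g"
    proof (rule nth_equalityI)
      fix i assume "i < length \<alpha>"
      then show "\<alpha> ! i = ?F g ! i"
        using bspec[OF pref, of "Suc i"] len by (simp del: upt_Suc)
    qed (simp add: len)
    have "k \<le> N"
      using card_image_le[of "{1..N}" g] g by simp
    moreover have "inj_on g {1..r}" using U distinct_iff[of g] \<alpha> by simp
    ultimately show "\<alpha> \<in> ?F ` ?G" using g \<alpha> by blast
  qed
qed

theorem theorem3p6:
  fixes r n :: nat
  assumes "r \<ge> 1"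
  shows "card {\<alpha>. unit_interval_parking_function (n + r) \<alpha> \<and> card (set (take r \<alpha>)) = r}
         = r_Fubini r n"
proof -
  let ?G = "\<lambda>k::nat. {g \<in> extensional {1..n+r}. g ` {1..n+r} = {..<k} \<and> inj_on g {1..r}}"
  have fin: "finite (?G k)" for k
    by (rule finite_subset[of _ "{1..n+r} \<rightarrow>\<^sub>E {..<k}"]) (auto simp: extensional_def intro: finite_PiE)
  have "card {\<alpha>. unit_interval_parking_function (n + r) \<alpha> \<and> card (set (take r \<alpha>)) = r}
      = card (\<Union>k\<le>n+r. ?G k)"
    using bij_betw_same_card[OF bij_betw_block_pref[of r "n + r"]] by simp
  \<comment> \<open>The image of \<open>g\<close> determines \<open>k\<close>, so the sets are
    pairwise disjoint.\<close>
  also have "\<dots> = (\<Sum>k\<le>n+r. card (?G k))"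
    by (rule card_UN_disjoint) (use fin in auto)
  also have "\<dots> = (\<Sum>k\<le>n+r. fact k * r_Stirling2 r (n + r) k)"
    by (intro sum.cong refl card_surjections_inj_on) simp
  \<comment> \<open>The terms with \<open>k < r\<close> vanish. The lower bound is written
    \<open>0+r\<close> so that the index shift below gives the summand in
    \<open>k + r\<close>.\<close>
  also have "\<dots> = (\<Sum>k=0+r..n+r. fact k * r_Stirling2 r (n + r) k)"
    by (rule sum.mono_neutral_right) (auto simp: r_Stirling2_eq_0)
  also have "\<dots> = r_Fubini r n"
    unfolding r_Fubini_def sum.shift_bounds_cl_nat_ivl ..
  finally show ?thesis .
qed

end
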